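(* Let $V:L^2[0,1]\to L^2[0,1]$ be the Volterra operator. If $n\ge 2$ is an integer, then \[ W(V^{-n})=\mathbb{C}. \]
   Context: $L^2[0,1]$ is the complex Hilbert space of (classes of) square-integrable complex-valued functions on $[0,1]$ with respect to Lebesgue measure, with inner product $\langle f,g\rangle=\int_0^1 f\overline{g}$. The Volterra operator is defined by $Vf(x):=\int_0^x f(t)\,dt$ for $f\in L^2[0,1]$; it is an injective bounded operator, hence so is each power $V^n$, $n\ge1$. $V^{-n}$ denotes the (unbounded) operator $(V^n)^{-1}$ with domain $D(V^{-n})=V^n(L^2[0,1])$ inverse to $V^n$. For a (possibly unbounded) operator $A$ with domain $D(A)\subset H$, where $H$ is a complex Hilbert space, the numerical range of $A$ is $W(A):=\{\langle Ax,x\rangle : x\in D(A),\ \|x\|=1\}$. *)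

theory Defs
  imports "HOL-Analysis.Analysis"
begin

section \<open>Complex inner product spaces, partially defined operators and the numerical range\<close>

text \<open>
  The scalar product is linear in the first argument and conjugate linear in the second one.
  Positive definiteness and the norm are inherited from the class of real inner product spaces;
  in particular the norm is the square root of \<open>cinner x x\<close>.
\<close>

class complex_inner = real_inner +
  fixes scaleC :: "complex \<Rightarrow> 'a \<Rightarrow> 'a"
    and cinner :: "'a \<Rightarrow> 'a \<Rightarrow> complex"
  assumes scaleR_scaleC: "scaleR r x = scaleC (complex_of_real r) x"
    and scaleC_add_right: "scaleC a (x + y) = scaleC a x + scaleC a y"
    and scaleC_add_left: "scaleC (a + b) x = scaleC a x + scaleC b x"
    and scaleC_scaleC: "scaleC a (scaleC b x) = scaleC (a * b) x"
    and cinner_commute: "cinner x y = cnj (cinner y x)"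
    and cinner_add_left: "cinner (x + y) z = cinner x z + cinner y z"
    and cinner_scaleC_left: "cinner (scaleC a x) y = a * cinner x y"
    and inner_eq_Re_cinner: "inner x y = Re (cinner x y)"

lemma cinner_self: "cinner x x = complex_of_real ((norm (x :: 'a :: complex_inner))\<^sup>2)"
proof -
  have "Im (cinner x x) = 0"
    using arg_cong[OF cinner_commute[of x x], of Im] by simp
  then show ?thesis
    by (simp add: complex_eq_iff power2_norm_eq_inner inner_eq_Re_cinner)
qed

text \<open>
  A possibly unbounded operator with domain \<open>D \<subseteq> H\<close> is a partial function on \<open>H\<close>; its domain
  is \<open>dom A\<close>.
\<close>

definition numerical_range :: "('a :: complex_inner \<rightharpoonup> 'a) \<Rightarrow> complex set" where
  "numerical_range A = {cinner (the (A x)) x | x. x \<in> dom A \<and> norm x = 1}"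

text \<open>The inverse of an injective operator \<open>T\<close>, with domain the range of \<open>T\<close>.\<close>

definition inverse_operator :: "('a \<Rightarrow> 'b) \<Rightarrow> ('b \<rightharpoonup> 'a)" where
  "inverse_operator T = (\<lambda>y. if y \<in> range T then Some (inv T y) else None)"

lemma dom_inverse_operator: "dom (inverse_operator T) = range T"
  by (auto simp: inverse_operator_def dom_def)

lemma inverse_operator_apply: "inj T \<Longrightarrow> inverse_operator T (T x) = Some x"
  by (simp add: inverse_operator_def)


section \<open>The space of square-integrable functions on the unit interval\<close>

abbreviation unit_interval_measure :: "real measure" where
  "unit_interval_measure \<equiv> lebesgue_on {0..1}"

definition square_integrable :: "(real \<Rightarrow> complex) \<Rightarrow> bool" where
  "square_integrable f \<longleftrightarrow> f \<in> borel_measurable unit_interval_measure \<and>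
     integrable unit_interval_measure (\<lambda>x. (cmod (f x))\<^sup>2)"

definition L2_eq :: "(real \<Rightarrow> complex) \<Rightarrow> (real \<Rightarrow> complex) \<Rightarrow> bool" where
  "L2_eq f g \<longleftrightarrow> square_integrable f \<and> square_integrable g \<and>
     (AE x in unit_interval_measure. f x = g x)"

lemma square_integrable_zero [simp]: "square_integrable (\<lambda>_. 0)"
  by (simp add: square_integrable_def)

lemma square_integrable_mult_cnj:
  assumes "square_integrable f" "square_integrable g"
  shows "integrable unit_interval_measure (\<lambda>x. f x * cnj (g x))"
proof (rule Bochner_Integration.integrable_bound)
  show "integrable unit_interval_measure (\<lambda>x. (cmod (f x))\<^sup>2 + (cmod (g x))\<^sup>2)"
    using assms by (simp add: square_integrable_def)
  show "(\<lambda>x. f x * cnj (g x)) \<in> borel_measurable unit_interval_measure"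
    using assms unfolding square_integrable_def
    by (intro borel_measurable_times borel_measurable_continuous_on[of cnj] continuous_intros) auto
  have "a * b \<le> a\<^sup>2 + b\<^sup>2" if "a \<ge> 0" "b \<ge> 0" for a b :: real
    using sum_squares_bound[of a b] mult_nonneg_nonneg[OF that] by linarith
  then show "AE x in unit_interval_measure.
      norm (f x * cnj (g x)) \<le> norm ((cmod (f x))\<^sup>2 + (cmod (g x))\<^sup>2)"
    by (simp add: norm_mult)
qed

lemma square_integrable_add:
  assumes "square_integrable f" "square_integrable g"
  shows "square_integrable (\<lambda>x. f x + g x)"
  unfolding square_integrable_def
proof
  show "(\<lambda>x. f x + g x) \<in> borel_measurable unit_interval_measure"
    using assms by (auto simp: square_integrable_def)
  show "integrable unit_interval_measure (\<lambda>x. (cmod (f x + g x))\<^sup>2)"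
  proof (rule Bochner_Integration.integrable_bound)
    show "integrable unit_interval_measure (\<lambda>x. 2 * (cmod (f x))\<^sup>2 + 2 * (cmod (g x))\<^sup>2)"
      using assms by (simp add: square_integrable_def)
    show "(\<lambda>x. (cmod (f x + g x))\<^sup>2) \<in> borel_measurable unit_interval_measure"
      using assms by (auto simp: square_integrable_def)
    have "(cmod (a + b))\<^sup>2 \<le> 2 * (cmod a)\<^sup>2 + 2 * (cmod b)\<^sup>2" for a b :: complex
    proof -
      have "(cmod (a + b))\<^sup>2 \<le> (cmod a + cmod b)\<^sup>2"
        by (intro power_mono norm_triangle_ineq) auto
      also have "\<dots> \<le> 2 * (cmod a)\<^sup>2 + 2 * (cmod b)\<^sup>2"
        using sum_squares_bound[of "cmod a" "cmod b"] by (simp add: power2_sum)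
      finally show ?thesis .
    qed
    then show "AE x in unit_interval_measure.
        norm ((cmod (f x + g x))\<^sup>2) \<le> norm (2 * (cmod (f x))\<^sup>2 + 2 * (cmod (g x))\<^sup>2)"
      by simp
  qed
qed

lemma square_integrable_mult:
  assumes "square_integrable f"
  shows "square_integrable (\<lambda>x. c * f x)"
  using assms by (auto simp: square_integrable_def norm_mult power_mult_distrib)

lemma square_integrable_uminus: "square_integrable f \<Longrightarrow> square_integrable (\<lambda>x. - f x)"
  using square_integrable_mult[of f "-1"] by simp

lemma square_integrable_diff:
  "square_integrable f \<Longrightarrow> square_integrable g \<Longrightarrow> square_integrable (\<lambda>x. f x - g x)"
  using square_integrable_add[of f "\<lambda>x. - g x"] square_integrable_uminus[of g] by simp

lemma L2_eq_cong:
  assumes "L2_eq f f'" "\<And>g. square_integrable g \<Longrightarrow> square_integrable (\<lambda>x. F (g x))"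
  shows "L2_eq (\<lambda>x. F (f x)) (\<lambda>x. F (f' x))"
proof -
  have "AE x in unit_interval_measure. f x = f' x"
    using assms(1) by (simp add: L2_eq_def)
  then have "AE x in unit_interval_measure. F (f x) = F (f' x)"
    by eventually_elim simp
  with assms show ?thesis
    by (simp add: L2_eq_def)
qed

lemma L2_eq_cong2:
  assumes f: "L2_eq f f'" and g: "L2_eq g g'"
    and F: "\<And>h k. square_integrable h \<Longrightarrow> square_integrable k \<Longrightarrow>
      square_integrable (\<lambda>x. F (h x) (k x))"
  shows "L2_eq (\<lambda>x. F (f x) (g x)) (\<lambda>x. F (f' x) (g' x))"
proof -
  have "AE x in unit_interval_measure. f x = f' x" "AE x in unit_interval_measure. g x = g' x"
    using f g by (simp_all add: L2_eq_def)
  then have "AE x in unit_interval_measure. F (f x) (g x) = F (f' x) (g' x)"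
    by eventually_elim simp
  with f g F show ?thesis
    by (simp add: L2_eq_def)
qed

quotient_type L2 = "real \<Rightarrow> complex" / partial: L2_eq
proof (rule part_equivpI)
  show "\<exists>f. L2_eq f f"
    by (rule exI[of _ "\<lambda>_. 0"]) (simp add: L2_eq_def)
  show "symp L2_eq"
    by (rule sympI) (simp add: L2_eq_def eq_commute)
  show "transp L2_eq"
  proof (rule transpI)
    fix f g h assume "L2_eq f g" "L2_eq g h"
    moreover from this have "AE x in unit_interval_measure. f x = g x"
      "AE x in unit_interval_measure. g x = h x"
      by (simp_all add: L2_eq_def)
    then have "AE x in unit_interval_measure. f x = h x"
      by eventually_elim simp
    ultimately show "L2_eq f h"
      by (simp add: L2_eq_def)
  qed
qed

instantiation L2 :: complex_inner
begin

lift_definition zero_L2 :: L2 is "\<lambda>_. 0"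
  by (simp add: L2_eq_def)

lift_definition plus_L2 :: "L2 \<Rightarrow> L2 \<Rightarrow> L2" is "\<lambda>f g x. f x + g x"
  by (rule L2_eq_cong2) (auto intro: square_integrable_add)

lift_definition minus_L2 :: "L2 \<Rightarrow> L2 \<Rightarrow> L2" is "\<lambda>f g x. f x - g x"
  by (rule L2_eq_cong2) (auto intro: square_integrable_diff)

lift_definition uminus_L2 :: "L2 \<Rightarrow> L2" is "\<lambda>f x. - f x"
  by (rule L2_eq_cong) (auto intro: square_integrable_uminus)

lift_definition scaleC_L2 :: "complex \<Rightarrow> L2 \<Rightarrow> L2" is "\<lambda>c f x. c * f x"
  by (rule L2_eq_cong) (auto intro: square_integrable_mult)

lift_definition cinner_L2 :: "L2 \<Rightarrow> L2 \<Rightarrow> complex"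
  is "\<lambda>f g. \<integral>x. f x * cnj (g x) \<partial>unit_interval_measure"
  unfolding L2_eq_def
  by (intro integral_cong_AE borel_measurable_integrable square_integrable_mult_cnj) auto

definition scaleR_L2 :: "real \<Rightarrow> L2 \<Rightarrow> L2" where
  "scaleR_L2 r = scaleC (complex_of_real r)"

definition inner_L2 :: "L2 \<Rightarrow> L2 \<Rightarrow> real" where
  "inner_L2 f g = Re (cinner f g)"

definition norm_L2 :: "L2 \<Rightarrow> real" where
  "norm_L2 f = sqrt (inner f f)"

definition sgn_L2 :: "L2 \<Rightarrow> L2" where
  "sgn_L2 f = inverse (norm f) *\<^sub>R f"

definition dist_L2 :: "L2 \<Rightarrow> L2 \<Rightarrow> real" where
  "dist_L2 f g = norm (f - g)"

definition uniformity_L2 :: "(L2 \<times> L2) filter" where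
  "uniformity_L2 = (INF e\<in>{0<..}. principal {(f, g). dist f g < e})"

definition open_L2 :: "L2 set \<Rightarrow> bool" where
  "open_L2 U \<longleftrightarrow> (\<forall>f\<in>U. eventually (\<lambda>(f', g). f' = f \<longrightarrow> g \<in> U) uniformity)"

instance
proof
  fix f g h :: L2 and a b :: complex and r s :: real
  show "f + g + h = f + (g + h)"
    by transfer (auto simp: L2_eq_def add.assoc intro!: square_integrable_add)
  show "f + g = g + f"
    by transfer (auto simp: L2_eq_def add.commute intro!: square_integrable_add)
  show "0 + f = f"
    by transfer (auto simp: L2_eq_def)
  show "- f + f = 0"
    by transfer (auto simp: L2_eq_def)
  show "f - g = f + - g"
    by transfer (auto simp: L2_eq_def intro!: square_integrable_diff)
  show C1: "scaleC a (f + g) = scaleC a f + scaleC a g" for a and f g :: L2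
    by transfer
       (auto simp: L2_eq_def distrib_left intro!: square_integrable_add square_integrable_mult)
  show C2: "scaleC (a + b) f = scaleC a f + scaleC b f" for a b and f :: L2
    by transfer
       (auto simp: L2_eq_def distrib_right intro!: square_integrable_add square_integrable_mult)
  show C3: "scaleC a (scaleC b f) = scaleC (a * b) f" for a b and f :: L2
    by transfer (auto simp: L2_eq_def mult.assoc intro!: square_integrable_mult)
  have C4: "scaleC 1 f = f" for f :: L2
    by transfer (auto simp: L2_eq_def)
  show "r *\<^sub>R f = scaleC (complex_of_real r) f"
    by (simp add: scaleR_L2_def)
  show "r *\<^sub>R (f + g) = r *\<^sub>R f + r *\<^sub>R g"
    by (simp add: scaleR_L2_def C1)
  show "(r + s) *\<^sub>R f = r *\<^sub>R f + s *\<^sub>R f"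
    by (simp add: scaleR_L2_def C2)
  show "r *\<^sub>R s *\<^sub>R f = (r * s) *\<^sub>R f"
    by (simp add: scaleR_L2_def C3)
  show "1 *\<^sub>R f = f"
    by (simp add: scaleR_L2_def C4)
  show "sgn f = inverse (norm f) *\<^sub>R f"
    by (fact sgn_L2_def)
  show "dist f g = norm (f - g)"
    by (fact dist_L2_def)
  show "uniformity = (INF e\<in>{0<..}. principal {(f :: L2, g). dist f g < e})"
    by (fact uniformity_L2_def)
  show "open U \<longleftrightarrow> (\<forall>f\<in>U. eventually (\<lambda>(f', g). f' = f \<longrightarrow> g \<in> U) uniformity)"
    for U :: "L2 set"
    by (fact open_L2_def)
  show I1: "cinner f g = cnj (cinner g f)" for f g :: L2
    by transfer (subst Bochner_Integration.integral_cnj[symmetric], simp add: mult.commute del: Bochner_Integration.integral_cnj)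
  show I2: "cinner (f + g) h = cinner f h + cinner g h" for f g h :: L2
    by transfer (simp add: L2_eq_def distrib_right square_integrable_mult_cnj)
  show I3: "cinner (scaleC a f) g = a * cinner f g" for a and f g :: L2
    by transfer (simp add: mult.assoc)
  show "inner f g = Re (cinner f g)"
    by (fact inner_L2_def)
  show "inner f g = inner g f"
    by (subst inner_L2_def, subst I1) (simp add: inner_L2_def)
  show "inner (f + g) h = inner f h + inner g h"
    by (simp add: inner_L2_def I2)
  show "inner (r *\<^sub>R f) g = r * inner f g"
    by (simp add: inner_L2_def scaleR_L2_def I3)
  have sq: "Re (\<integral>x. f x * cnj (f x) \<partial>unit_interval_measure) =
      (\<integral>x. (cmod (f x))\<^sup>2 \<partial>unit_interval_measure)" for f :: "real \<Rightarrow> complex"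
    by (simp only: complex_norm_square[symmetric] integral_complex_of_real Re_complex_of_real)
  show "0 \<le> inner f f"
    unfolding inner_L2_def by transfer (simp add: sq)
  show "inner f f = 0 \<longleftrightarrow> f = 0"
    unfolding inner_L2_def
  proof transfer
    fix f assume f: "L2_eq f f"
    then have "(\<integral>x. (cmod (f x))\<^sup>2 \<partial>unit_interval_measure) = 0 \<longleftrightarrow>
        (AE x in unit_interval_measure. (cmod (f x))\<^sup>2 = 0)"
      by (intro integral_nonneg_eq_0_iff_AE) (simp_all add: L2_eq_def square_integrable_def)
    with f show "Re (\<integral>x. f x * cnj (f x) \<partial>unit_interval_measure) = 0 \<longleftrightarrow> L2_eq f (\<lambda>_. 0)"
      unfolding sq by (simp add: L2_eq_def)
  qed
  show "norm f = sqrt (inner f f)"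
    by (fact norm_L2_def)
qed

end


section \<open>The Volterra operator\<close>

lemma square_integrable_imp_integrable:
  assumes "square_integrable f"
  shows "integrable unit_interval_measure f"
proof -
  have "square_integrable (\<lambda>_. 1)"
    by (simp add: square_integrable_def finite_measure.integrable_const finite_measure_lebesgue_on)
  from square_integrable_mult_cnj[OF assms this] show ?thesis by simp
qed

lemma integrable_subinterval_lebesgue_on:
  assumes "integrable unit_interval_measure (f :: real \<Rightarrow> complex)" "x \<le> 1"
  shows "integrable (lebesgue_on {0..x}) f"
  using assms Equivalence_Lebesgue_Henstock_Integration.integrable_subinterval[of 0 1 f 0 x] by (cases "0 \<le> x") auto

lemma continuous_on_volterra:
  assumes "integrable unit_interval_measure (f :: real \<Rightarrow> complex)"
  shows "continuous_on {0..1} (\<lambda>x. integral\<^sup>L (lebesgue_on {0..x}) f)"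
proof -
  have "continuous_on {0..1} (\<lambda>x. integral {0..x} f)"
    using assms by (intro indefinite_integral_continuous_1 integrable_on_lebesgue_on) auto
  then show ?thesis
    by (rule continuous_on_eq)
       (auto intro!: lebesgue_integral_eq_integral[symmetric]
          integrable_subinterval_lebesgue_on[OF assms])
qed

lemma square_integrable_continuous_on:
  assumes "continuous_on {0..1} f"
  shows "square_integrable f"
  unfolding square_integrable_def
proof
  show "f \<in> borel_measurable unit_interval_measure"
    using assms by (intro continuous_imp_measurable_on_sets_lebesgue) auto
  show "integrable unit_interval_measure (\<lambda>x. (cmod (f x))\<^sup>2)"
    using assms by (intro continuous_imp_integrable_real continuous_intros)
qed

lemma volterra_cong:
  assumes "L2_eq f g"
  shows "L2_eq (\<lambda>x. \<integral>t. f t \<partial>lebesgue_on {0..x}) (\<lambda>x. \<integral>t. g t \<partial>lebesgue_on {0..x})"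
proof -
  have int: "integrable unit_interval_measure f" "integrable unit_interval_measure g"
    using assms by (simp_all add: L2_eq_def square_integrable_imp_integrable)
  have eq: "(\<integral>t. f t \<partial>lebesgue_on {0..x}) = (\<integral>t. g t \<partial>lebesgue_on {0..x})" if "x \<le> 1" for x
  proof (rule integral_cong_AE)
    show "f \<in> borel_measurable (lebesgue_on {0..x})" "g \<in> borel_measurable (lebesgue_on {0..x})"
      by (rule borel_measurable_integrable[OF integrable_subinterval_lebesgue_on[OF _ that]],
          rule int)+
    have "AE t in unit_interval_measure. f t = g t"
      using assms by (simp only: L2_eq_def)
    then have "AE t in lebesgue. t \<in> {0..1} \<longrightarrow> f t = g t"
      by (subst (asm) AE_restrict_space_iff) auto
    then have "AE t in lebesgue. t \<in> {0..x} \<longrightarrow> f t = g t"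
      by eventually_elim (use that in auto)
    then show "AE t in lebesgue_on {0..x}. f t = g t"
      by (subst AE_restrict_space_iff) auto
  qed
  have "AE x in unit_interval_measure.
      (\<integral>t. f t \<partial>lebesgue_on {0..x}) = (\<integral>t. g t \<partial>lebesgue_on {0..x})"
    by (rule AE_I2, rule eq) simp
  moreover have "square_integrable (\<lambda>x. \<integral>t. f t \<partial>lebesgue_on {0..x})"
    by (rule square_integrable_continuous_on[OF continuous_on_volterra[OF int(1)]])
  moreover have "square_integrable (\<lambda>x. \<integral>t. g t \<partial>lebesgue_on {0..x})"
    by (rule square_integrable_continuous_on[OF continuous_on_volterra[OF int(2)]])
  ultimately show ?thesis
    unfolding L2_eq_def by (intro conjI)
qed

lift_definition volterra :: "L2 \<Rightarrow> L2" is "\<lambda>f x. \<integral>t. f t \<partial>lebesgue_on {0..x}"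
  by (rule volterra_cong)

end

theory Submission
  imports Defs "HOL-Real_Asymp.Real_Asymp"
begin

text \<open>
  A number \<open>z\<close> lies in \<open>W(V\<^sup>-\<^sup>n)\<close> as soon as some \<open>u\<close> with \<open>V\<^sup>n u \<noteq> 0\<close> satisfies
  \<open>\<langle>u, V\<^sup>n u\<rangle> = z \<parallel>V\<^sup>n u\<parallel>\<^sup>2\<close>, since both sides scale in the same way and \<open>V\<^sup>n u\<close> can be normalised
  (lemma \<open>numerical_range_inverse_operatorI\<close>).  Such a \<open>u\<close> can be found among the combinations of
  two monomials: up to a factor \<open>V\<^sup>n\<close> sends \<open>x\<^sup>j\<close> to \<open>x\<^sup>j\<^sup>+\<^sup>n\<close>, so there is a \<open>u\<close> with
  \<open>V\<^sup>n u = x\<^sup>n + b x\<^sup>m\<close> for every \<open>m > n\<close> and every complex number \<open>b\<close>.  With \<open>m = j + n\<close> and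
  \<open>K = m! / j!\<close> the equation for \<open>b\<close> becomes
  \<open>c\<^sub>0 + c\<^sub>1 b + c\<^sub>2 b' + c\<^sub>3 \<bar>b\<bar>\<^sup>2 = 0\<close>, where \<open>b'\<close> is the conjugate of \<open>b\<close>.

  For large \<open>j\<close> the coefficients \<open>c\<^sub>0\<close> and \<open>c\<^sub>2\<close> stay bounded, \<open>c\<^sub>1\<close> is about \<open>K / (m + 1)\<close>, and
  \<open>c\<^sub>3\<close> is only about half as large as \<open>c\<^sub>1\<close>.  Because \<open>n \<ge> 2\<close>, the number \<open>K\<close> grows at least
  quadratically in \<open>j\<close>, so \<open>c\<^sub>1\<close> eventually dominates the three other coefficients together
  (lemma \<open>leading_coefficient_dominates\<close>).  The equation is then a fixed point equation for a
  continuous self-map of the closed unit disc, and Brouwer's theorem provides a solution \<open>b\<close>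
  (lemma \<open>dominated_quadratic_has_zero\<close>).

  The inverse operator is meaningful only because \<open>V\<close> is injective, which follows from
  Lebesgue's differentiation theorem: a function all of whose integrals over \<open>[0, x]\<close> vanish is zero
  almost everywhere (lemma \<open>AE_zero_if_indefinite_integral_zero\<close>).
\<close>

section \<open>Inner products and inverse operators\<close>

lemma cinner_add_right:
  "cinner x (y + z) = cinner x y + cinner (x :: 'a :: complex_inner) z"
  by (metis cinner_add_left cinner_commute complex_cnj_add)

lemma cinner_scaleC_right:
  "cinner x (scaleC a y) = cnj a * cinner (x :: 'a :: complex_inner) y"
  by (metis cinner_scaleC_left cinner_commute complex_cnj_mult)

lemma scaleC_one: "scaleC 1 x = (x :: 'a :: complex_inner)"
  using scaleR_scaleC[of 1 x] by simp

lemma numerical_range_inverse_operatorI: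
  fixes T :: "'a :: complex_inner \<Rightarrow> 'a"
  assumes inj: "inj T"
    and scale: "\<And>c x. T (scaleC c x) = scaleC c (T x)"
    and nonzero: "T u \<noteq> 0"
    and eq: "cinner u (T u) = z * cinner (T u) (T u)"
  shows "z \<in> numerical_range (inverse_operator T)"
proof -
  define c where "c = complex_of_real (1 / norm (T u))"
  have Tcu: "T (scaleC c u) = (1 / norm (T u)) *\<^sub>R T u"
    by (simp add: scale c_def scaleR_scaleC)
  have "norm (T (scaleC c u)) = 1"
    unfolding Tcu using nonzero by simp
  moreover from this have "cinner (T (scaleC c u)) (T (scaleC c u)) = 1"
    by (simp add: cinner_self)
  then have "cinner (scaleC c u) (T (scaleC c u)) = z"
    using eq by (simp add: scale cinner_scaleC_left cinner_scaleC_right mult.left_commute)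
  ultimately show ?thesis
    unfolding numerical_range_def dom_inverse_operator
    by (intro CollectI exI[of _ "T (scaleC c u)"])
       (simp add: inverse_operator_apply[OF inj])
qed


section \<open>The Volterra operator is linear and injective\<close>

lemma L2_eqI:
  assumes "square_integrable f" "square_integrable g" "\<And>x. 0 \<le> x \<Longrightarrow> x \<le> 1 \<Longrightarrow> f x = g x"
  shows "L2_eq f g"
  using assms by (auto simp: L2_eq_def intro!: AE_I2)

lemma square_integrable_volterra:
  "square_integrable f \<Longrightarrow> square_integrable (\<lambda>x. \<integral>t. f t \<partial>lebesgue_on {0..x})"
  by (rule square_integrable_continuous_on, rule continuous_on_volterra,
      rule square_integrable_imp_integrable)

lemma volterra_add: "volterra (f + g) = volterra f + volterra g"
proof transfer
  fix f g assume "L2_eq f f" "L2_eq g g"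
  then have sq: "square_integrable f" "square_integrable g"
    by (simp_all add: L2_eq_def)
  show "L2_eq (\<lambda>x. \<integral>t. f t + g t \<partial>lebesgue_on {0..x})
      (\<lambda>x. (\<integral>t. f t \<partial>lebesgue_on {0..x}) + (\<integral>t. g t \<partial>lebesgue_on {0..x}))"
  proof (rule L2_eqI)
    show "(\<integral>t. f t + g t \<partial>lebesgue_on {0..x}) =
        (\<integral>t. f t \<partial>lebesgue_on {0..x}) + (\<integral>t. g t \<partial>lebesgue_on {0..x})" if "x \<le> 1" for x
      using sq[THEN square_integrable_imp_integrable,
          THEN integrable_subinterval_lebesgue_on, OF that]
      by (rule Bochner_Integration.integral_add)
  qed (rule square_integrable_volterra square_integrable_add sq)+
qed

lemma volterra_scaleC: "volterra (scaleC c f) = scaleC c (volterra f)"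
proof transfer
  fix c f assume "L2_eq f f"
  then have sq: "square_integrable f"
    by (simp add: L2_eq_def)
  show "L2_eq (\<lambda>x. \<integral>t. c * f t \<partial>lebesgue_on {0..x})
      (\<lambda>x. c * (\<integral>t. f t \<partial>lebesgue_on {0..x}))"
    by (rule L2_eqI[OF square_integrable_volterra[OF square_integrable_mult[OF sq]]
          square_integrable_mult[OF square_integrable_volterra[OF sq]]]) simp
qed

lemma volterra_power_add: "(volterra ^^ n) (f + g) = (volterra ^^ n) f + (volterra ^^ n) g"
  by (induction n) (simp_all add: volterra_add)

lemma volterra_power_scaleC: "(volterra ^^ n) (scaleC c f) = scaleC c ((volterra ^^ n) f)"
  by (induction n) (simp_all add: volterra_scaleC)

text \<open>
  The mean values of \<open>f\<close> over the intervals \<open>[x, x + h]\<close> tend to \<open>f x\<close> for almost every \<open>x\<close>, and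
  here they are all zero.
\<close>

lemma AE_zero_if_indefinite_integral_zero:
  fixes f :: "real \<Rightarrow> complex"
  assumes f: "integrable unit_interval_measure f"
    and zero: "\<And>x. 0 \<le> x \<Longrightarrow> x \<le> 1 \<Longrightarrow> (\<integral>t. f t \<partial>lebesgue_on {0..x}) = 0"
  shows "AE x in unit_interval_measure. f x = 0"
proof -
  define g where "g x = (if x \<in> {0..1} then f x else 0)" for x
  have f_on: "f integrable_on {0..1}"
    using f by (intro integrable_on_lebesgue_on) auto
  then have "g integrable_on UNIV"
    unfolding g_def by (subst integrable_restrict_UNIV)
  then have "g integrable_on cbox a b" for a b
    by (rule integrable_on_subcbox) auto
  then obtain N where N: "negligible N" and
    mean: "\<And>x e. \<lbrakk>x \<notin> N; 0 < e\<rbrakk> \<Longrightarrow> \<exists>d>0. \<forall>h. 0 < h \<and> h < d \<longrightarrow>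
      norm (integral (cbox x (x + h *\<^sub>R One)) g /\<^sub>R h ^ DIM(real) - g x) < e"
    by (rule integrable_ccontinuous_explicit) blast
  have prim: "integral {0..x} f = 0" if "0 \<le> x" "x \<le> 1" for x
    using zero[OF that] integrable_subinterval_lebesgue_on[OF f that(2)]
    by (subst lebesgue_integral_eq_integral[symmetric]) auto
  have short: "integral {x..x + h} g = 0" if "0 \<le> x" "0 < h" "x + h \<le> 1" for x h
  proof -
    have "integral {x..x + h} g = integral {x..x + h} f"
      using that by (intro integral_cong) (auto simp: g_def)
    also have "\<dots> = integral {0..x + h} f - integral {0..x} f"
      using that
        Henstock_Kurzweil_Integration.integral_combine[of 0 x "x + h" f]
        integrable_on_subinterval[OF f_on, of 0 "x + h"]
      by (auto simp: algebra_simps)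
    also have "\<dots> = 0"
      using that by (simp add: prim)
    finally show ?thesis .
  qed
  have "f x = 0" if x: "x \<notin> N" "0 \<le> x" "x < 1" for x
  proof (rule ccontr)
    assume "f x \<noteq> 0"
    then obtain d where d: "d > 0" and small: "\<And>h. 0 < h \<Longrightarrow> h < d \<Longrightarrow>
        norm (integral (cbox x (x + h *\<^sub>R One)) g /\<^sub>R h ^ DIM(real) - g x) < norm (f x)"
      using mean[OF x(1), of "norm (f x)"] by auto
    define h where "h = min (d / 2) (1 - x)"
    have "0 < h" "h < d" "x + h \<le> 1"
      using d x by (auto simp: h_def)
    with small[of h] short[of x h] x show False
      by (simp add: g_def)
  qed
  moreover have "negligible (insert 1 N)"
    using N by simp
  ultimately have "AE x in lebesgue. x \<in> {0..1} \<longrightarrow> f x = 0"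
    by (intro AE_I'[of "insert 1 N"]) (force simp: negligible_iff_null_sets)+
  then show ?thesis
    by (subst AE_restrict_space_iff) auto
qed

text \<open>
  The equation \<open>V f = 0\<close> holds in \<open>L\<^sup>2\<close>, hence only almost everywhere; continuity of the
  indefinite integral makes it hold at every point.
\<close>

lemma continuous_AE_zero_imp_zero:
  fixes F :: "real \<Rightarrow> complex"
  assumes cont: "continuous_on {0..1} F"
    and AE: "AE x in unit_interval_measure. F x = 0"
    and x: "0 \<le> x" "x \<le> 1"
  shows "F x = 0"
proof -
  have "AE x in lebesgue. x \<in> {0..1} \<longrightarrow> F x = 0"
    using AE by (subst (asm) AE_restrict_space_iff) auto
  then obtain N where N: "N \<in> null_sets lebesgue"
    and off_N: "\<And>x. x \<in> space lebesgue - N \<Longrightarrow> x \<in> {0..1} \<longrightarrow> F x = 0"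
    by (rule AE_E3) blast
  have "((\<lambda>x. norm (F x)) has_integral 0) (cbox 0 1)"
    by (rule has_integral_spike[of N _ _ "\<lambda>_. 0"])
       (use N off_N in \<open>auto simp: negligible_iff_null_sets\<close>)
  then have "norm (F x) = 0"
    using x by (intro has_integral_0_cbox_imp_0[of 0 1 "\<lambda>x. norm (F x)"])
      (auto intro!: continuous_intros cont)
  then show ?thesis
    by simp
qed

lemma volterra_eq_0_imp_eq_0: "volterra f = 0 \<Longrightarrow> f = 0"
proof transfer
  fix f
  assume f: "L2_eq f f" and V: "L2_eq (\<lambda>x. \<integral>t. f t \<partial>lebesgue_on {0..x}) (\<lambda>_. 0)"
  have int: "integrable unit_interval_measure f"
    using f by (simp add: L2_eq_def square_integrable_imp_integrable)
  have "(\<integral>t. f t \<partial>lebesgue_on {0..x}) = 0" if "0 \<le> x" "x \<le> 1" for x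
    by (rule continuous_AE_zero_imp_zero[OF continuous_on_volterra[OF int] _ that])
       (use V in \<open>simp add: L2_eq_def\<close>)
  from AE_zero_if_indefinite_integral_zero[OF int this] f show "L2_eq f (\<lambda>_. 0)"
    by (simp add: L2_eq_def)
qed

lemma inj_volterra: "inj volterra"
proof (rule injI)
  fix f g assume "volterra f = volterra g"
  moreover have "volterra f = volterra (f - g) + volterra g"
    by (simp flip: volterra_add)
  ultimately show "f = g"
    using volterra_eq_0_imp_eq_0[of "f - g"] by simp
qed

lemma inj_volterra_power: "inj (volterra ^^ n)"
  using inj_volterra by (rule inj_fn)


section \<open>Monomials\<close>

lift_definition monomial :: "nat \<Rightarrow> L2" is "\<lambda>k x. complex_of_real (x ^ k)"
  by (rule L2_eqI; (rule refl square_integrable_continuous_on)?; intro continuous_intros)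

lemma integral_monomial:
  assumes "0 \<le> x"
  shows "(\<integral>t. complex_of_real (t ^ k) \<partial>lebesgue_on {0..x}) =
    complex_of_real (x ^ Suc k / (real k + 1))"
proof -
  have "((\<lambda>t. t ^ Suc k / (real k + 1)) has_real_derivative t ^ k) (at t within {0..x})" for t
    using DERIV_cdivide[OF DERIV_pow[of "Suc k" t "{0..x}"], of "real k + 1"]
    by (simp add: add.commute)
  then have "((\<lambda>t. t ^ k) has_integral x ^ Suc k / (real k + 1) - 0 ^ Suc k / (real k + 1)) {0..x}"
    using assms
    by (intro fundamental_theorem_of_calculus)
       (simp_all flip: has_real_derivative_iff_has_vector_derivative)
  then have "integral {0..x} (\<lambda>t. t ^ k) = x ^ Suc k / (real k + 1)"
    by (simp add: integral_unique)
  moreover have "integrable (lebesgue_on {0..x}) (\<lambda>t. t ^ k)"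
    by (intro continuous_imp_integrable_real continuous_intros)
  then have "(\<integral>t. t ^ k \<partial>lebesgue_on {0..x}) = integral {0..x} (\<lambda>t. t ^ k)"
    by (rule lebesgue_integral_eq_integral) simp
  ultimately show ?thesis
    by (simp only: integral_complex_of_real)
qed

lemma cinner_monomial:
  "cinner (monomial i) (monomial j) = complex_of_real (1 / (real i + real j + 1))"
  by transfer (use integral_monomial[of 1] in \<open>simp flip: power_add\<close>)

lemma volterra_monomial:
  "volterra (monomial k) = scaleC (complex_of_real (1 / (real k + 1))) (monomial (Suc k))"
proof transfer
  fix k
  show "L2_eq (\<lambda>x. \<integral>t. complex_of_real (t ^ k) \<partial>lebesgue_on {0..x})
      (\<lambda>x. complex_of_real (1 / (real k + 1)) * complex_of_real (x ^ Suc k))"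
  proof (rule L2_eqI)
    show "square_integrable (\<lambda>x. \<integral>t. complex_of_real (t ^ k) \<partial>lebesgue_on {0..x})"
      by (rule square_integrable_volterra, rule square_integrable_continuous_on)
         (intro continuous_intros)
    show "square_integrable (\<lambda>x. complex_of_real (1 / (real k + 1)) * complex_of_real (x ^ Suc k))"
      by (rule square_integrable_continuous_on) (intro continuous_intros)
    show "(\<integral>t. complex_of_real (t ^ k) \<partial>lebesgue_on {0..x}) =
        complex_of_real (1 / (real k + 1)) * complex_of_real (x ^ Suc k)" if "0 \<le> x" for x
      unfolding integral_monomial[OF that] by simp
  qed
qed

lemma volterra_power_monomial:
  "(volterra ^^ n) (monomial j) =
    scaleC (complex_of_real (fact j / fact (j + n))) (monomial (j + n))"
proof (induction n)
  case 0
  show ?case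
    by (simp add: scaleC_one)
next
  case (Suc n)
  then show ?case
    by (simp add: volterra_scaleC volterra_monomial scaleC_scaleC ac_simps)
qed


section \<open>A quadratic equation in \<open>b\<close> and its conjugate\<close>

text \<open>
  Solved for the \<open>b\<close> of the dominating term, the equation reads \<open>b = F b\<close>, and the hypothesis
  says that \<open>F\<close> maps the closed unit disc into itself.  Dependence on the conjugate rules out
  arguments about holomorphic functions, but not Brouwer's theorem.
\<close>

lemma dominated_quadratic_has_zero:
  assumes dom: "cmod c0 + cmod c2 + cmod c3 \<le> cmod c1" and nonzero: "c1 \<noteq> 0"
  obtains b where "cmod b \<le> 1" "c0 + c1 * b + c2 * cnj b + c3 * (b * cnj b) = 0"
proof -
  define F where "F b = - (c0 + c2 * cnj b + c3 * (b * cnj b)) / c1" for b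
  have "cmod (F b) \<le> 1" if b: "cmod b \<le> 1" for b
  proof -
    have "cmod (c0 + c2 * cnj b + c3 * (b * cnj b))
        \<le> cmod c0 + cmod c2 * cmod b + cmod c3 * (cmod b * cmod b)"
      by (intro norm_triangle_le add_mono) (auto simp: norm_mult)
    also have "\<dots> \<le> cmod c0 + cmod c2 * 1 + cmod c3 * (1 * 1)"
      using b by (intro add_mono mult_left_mono mult_mono) auto
    also have "\<dots> \<le> cmod c1"
      using dom by simp
    finally show ?thesis
      using nonzero by (simp add: F_def norm_divide del: minus_add_distrib)
  qed
  then have "F \<in> cball 0 1 \<rightarrow> cball 0 1"
    by auto
  moreover have "continuous_on (cball 0 1) F"
    unfolding F_def using nonzero by (intro continuous_intros) auto
  moreover have "cball 0 1 \<noteq> ({} :: complex set)"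
    by simp
  ultimately obtain b where "b \<in> cball 0 1" "F b = b"
    using brouwer[OF compact_cball convex_cball] by blast
  then show thesis
    using nonzero by (intro that[of b]) (auto simp: F_def field_simps add_eq_0_iff)
qed

text \<open>
  The coefficients are those of \<open>\<langle>u, V\<^sup>n u\<rangle> - z \<parallel>V\<^sup>n u\<parallel>\<^sup>2\<close> for \<open>V\<^sup>n u = x\<^sup>n + b x\<^sup>j\<^sup>+\<^sup>n\<close>.  All terms
  without the factor \<open>K = (j + n)! / j!\<close> contribute at most \<open>2 n! + 4 \<bar>z\<bar>\<close>, so what matters is that
  \<open>K (1 / (j + n + 1) - 1 / (2 j + n + 1))\<close> is unbounded, which follows from
  \<open>K \<ge> (j + 1) (j + 2)\<close> for \<open>n \<ge> 2\<close>.
\<close>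

lemma leading_coefficient_dominates:
  fixes n :: nat and z :: complex
  assumes n: "n \<ge> 2"
  obtains j :: nat where "j > 0" and
    "cmod (of_real (fact n / (real n + 1)) - z * of_real (1 / (2 * real n + 1))) +
     cmod (of_real (fact n / (real j + real n + 1)) - z * of_real (1 / (real j + 2 * real n + 1))) +
     cmod (of_real (fact (j + n) / fact j / (2 * real j + real n + 1)) -
       z * of_real (1 / (2 * real j + 2 * real n + 1)))
     < cmod (of_real (fact (j + n) / fact j / (real j + real n + 1)) -
       z * of_real (1 / (real j + 2 * real n + 1)))"
proof -
  have "filterlim (\<lambda>j. (real j + 1) * (real j + 2) *
      (1 / (real j + real n + 1) - 1 / (2 * real j + real n + 1))) at_top sequentially"
    by real_asymp
  then have "eventually (\<lambda>j. (real j + 1) * (real j + 2) *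
      (1 / (real j + real n + 1) - 1 / (2 * real j + real n + 1)) > 2 * fact n + 4 * cmod z)
      sequentially"
    by (simp add: filterlim_at_top_dense)
  then have "eventually (\<lambda>j. (real j + 1) * (real j + 2) *
      (1 / (real j + real n + 1) - 1 / (2 * real j + real n + 1)) > 2 * fact n + 4 * cmod z \<and> j > 0)
      sequentially"
    using eventually_gt_at_top[of 0] by eventually_elim simp
  then obtain j where j: "j > 0" and large: "2 * fact n + 4 * cmod z < (real j + 1) * (real j + 2) *
      (1 / (real j + real n + 1) - 1 / (2 * real j + real n + 1))"
    by (auto simp: eventually_sequentially)
  define K :: real where "K = fact (j + n) / fact j"
  have "(real j + 1) * (real j + 2) * fact j = fact (j + 2)"
    by (simp add: algebra_simps)
  also have "\<dots> \<le> (fact (j + n) :: real)"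
    using n by (intro fact_mono) auto
  finally have K: "(real j + 1) * (real j + 2) \<le> K"
    by (simp add: K_def field_simps)
  have K0: "K \<ge> 0"
    by (simp add: K_def)
  have "(real j + 1) * (real j + 2) * (1 / (real j + real n + 1) - 1 / (2 * real j + real n + 1))
      \<le> K * (1 / (real j + real n + 1) - 1 / (2 * real j + real n + 1))"
    by (intro mult_right_mono K) (simp add: field_simps)
  with large have gap: "2 * fact n + 4 * cmod z <
      K / (real j + real n + 1) - K / (2 * real j + real n + 1)"
    by (simp add: right_diff_distrib)
  have zbound: "cmod (z * of_real (1 / r)) \<le> cmod z" if "r \<ge> 1" for r :: real
    using that mult_right_mono[OF that norm_ge_zero[of z]]
    by (simp add: norm_mult norm_divide divide_le_eq mult.commute)
  have fbound: "(fact n :: real) / r \<le> fact n" if "r \<ge> 1" for r :: real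
    using that by (simp add: field_simps)
  have upper: "cmod (of_real a - z * of_real (1 / r)) \<le> a + cmod z" if "a \<ge> 0" "r \<ge> 1" for a r :: real
    using norm_triangle_ineq4[of "of_real a" "z * of_real (1 / r)"] zbound[OF that(2)] that(1) by simp
  have lower: "a - cmod z \<le> cmod (of_real a - z * of_real (1 / r))" if "a \<ge> 0" "r \<ge> 1" for a r :: real
    using norm_triangle_ineq2[of "of_real a" "z * of_real (1 / r)"] zbound[OF that(2)] that(1) by simp
  show thesis
  proof (rule that[OF j], fold K_def)
    have "cmod (of_real (fact n / (real n + 1)) - z * of_real (1 / (2 * real n + 1)))
        \<le> fact n + cmod z"
      using upper[of "fact n / (real n + 1)" "2 * real n + 1"] fbound[of "real n + 1"] by simp
    moreover have "cmod (of_real (fact n / (real j + real n + 1)) -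
        z * of_real (1 / (real j + 2 * real n + 1))) \<le> fact n + cmod z"
      using upper[of "fact n / (real j + real n + 1)" "real j + 2 * real n + 1"]
        fbound[of "real j + real n + 1"] by simp
    moreover have "cmod (of_real (K / (2 * real j + real n + 1)) -
        z * of_real (1 / (2 * real j + 2 * real n + 1))) \<le> K / (2 * real j + real n + 1) + cmod z"
      using K0 by (intro upper) auto
    moreover have "K / (real j + real n + 1) - cmod z \<le> cmod (of_real (K / (real j + real n + 1)) -
       z * of_real (1 / (real j + 2 * real n + 1)))"
      using K0 by (intro lower) auto
    ultimately show "cmod (of_real (fact n / (real n + 1)) - z * of_real (1 / (2 * real n + 1))) +
      cmod (of_real (fact n / (real j + real n + 1)) - z * of_real (1 / (real j + 2 * real n + 1))) +
      cmod (of_real (K / (2 * real j + real n + 1)) -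
        z * of_real (1 / (2 * real j + 2 * real n + 1)))
      < cmod (of_real (K / (real j + real n + 1)) -
        z * of_real (1 / (real j + 2 * real n + 1)))"
      using gap by linarith
  qed
qed


section \<open>The numerical range of the inverse powers\<close>

text \<open>
  A zero combination would be orthogonal to \<open>x\<^sup>i\<close>, which forces \<open>b = - (i + k + 1) / (2 i + 1)\<close>,
  a number of modulus greater than \<open>1\<close>.
\<close>

lemma monomial_combination_nonzero:
  assumes "i < k" "cmod b \<le> 1"
  shows "monomial i + scaleC b (monomial k) \<noteq> 0"
proof
  define s t where "s = 2 * real i + 1" and "t = real i + real k + 1"
  have st: "0 < s" "s < t"
    using assms(1) by (auto simp: s_def t_def)
  assume zero: "monomial i + scaleC b (monomial k) = 0"
  have "cinner (0 :: L2) (monomial i) = 0"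
    using cinner_add_left[of 0 0 "monomial i"] by simp
  then have "complex_of_real (1 / s) + b * complex_of_real (1 / t) = 0"
    by (simp flip: zero add: cinner_add_left cinner_scaleC_left cinner_monomial
        s_def t_def add_ac)
  then have "b = - complex_of_real (t / s)"
    using st by (simp add: field_simps add_eq_0_iff)
  then have "cmod b = t / s"
    using st by (simp add: norm_divide)
  with st assms(2) show False
    by (simp add: field_simps)
qed

theorem theorem1p5:
  fixes n :: nat
  assumes "n \<ge> 2"
  shows "numerical_range (inverse_operator (volterra ^^ n)) = (UNIV :: complex set)"
proof -
  have "z \<in> numerical_range (inverse_operator (volterra ^^ n))" for z
  proof -
    obtain j where j: "j > 0" and dom:
      "cmod (of_real (fact n / (real n + 1)) - z * of_real (1 / (2 * real n + 1))) +
       cmod (of_real (fact n / (real j + real n + 1)) - z * of_real (1 / (real j + 2 * real n + 1))) +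
       cmod (of_real (fact (j + n) / fact j / (2 * real j + real n + 1)) -
         z * of_real (1 / (2 * real j + 2 * real n + 1)))
       < cmod (of_real (fact (j + n) / fact j / (real j + real n + 1)) -
         z * of_real (1 / (real j + 2 * real n + 1)))"
      (is "cmod ?c0 + cmod ?c2 + cmod ?c3 < cmod ?c1")
      by (rule leading_coefficient_dominates[OF assms])
    from dom have "?c1 \<noteq> 0"
      by (metis add_nonneg_nonneg norm_ge_zero norm_zero not_less)
    then obtain b where b: "cmod b \<le> 1"
      and root: "?c0 + ?c1 * b + ?c2 * cnj b + ?c3 * (b * cnj b) = 0"
      using dominated_quadratic_has_zero[OF less_imp_le[OF dom]] by blast
    define K :: real where "K = fact (j + n) / fact j"
    have K: "complex_of_real K * complex_of_real (fact j / fact (j + n)) = 1"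
      unfolding K_def of_real_mult[symmetric] by simp
    \<comment> \<open>The scalars cancel those in \<open>V\<^sup>n 1 = x\<^sup>n / n!\<close> and \<open>V\<^sup>n x\<^sup>j = x\<^sup>j\<^sup>+\<^sup>n / K\<close>.\<close>
    define u where "u = scaleC (complex_of_real (fact n)) (monomial 0) +
      scaleC (b * complex_of_real K) (monomial j)"
    have Vu: "(volterra ^^ n) u = monomial n + scaleC b (monomial (j + n))"
      using K by (simp add: u_def volterra_power_add volterra_power_scaleC
          volterra_power_monomial scaleC_scaleC scaleC_one mult.assoc)
    show ?thesis
    proof (rule numerical_range_inverse_operatorI[where u = u])
      show "(volterra ^^ n) u \<noteq> 0"
        unfolding Vu using j b by (intro monomial_combination_nonzero) auto
      have "cinner u ((volterra ^^ n) u) - z * cinner ((volterra ^^ n) u) ((volterra ^^ n) u) =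
          ?c0 + ?c1 * b + ?c2 * cnj b + ?c3 * (b * cnj b)"
        unfolding Vu unfolding u_def
        by (simp add: cinner_add_left cinner_add_right cinner_scaleC_left cinner_scaleC_right
            cinner_monomial flip: K_def) (simp add: algebra_simps)
      with root show "cinner u ((volterra ^^ n) u) =
          z * cinner ((volterra ^^ n) u) ((volterra ^^ n) u)"
        by simp
    qed (rule inj_volterra_power volterra_power_scaleC)+
  qed
  then show ?thesis
    by auto
qed

end
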